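(* The Twin Prime Conjecture (there are infinitely many primes $p$ such that $p+2$ is also prime) is true if and only if there exist infinitely many $n \in \mathbb{N}$ such that, for all $x, y \in \mathbb{N}$, $n \neq 6xy + x - y$ and $n \neq 6xy + x + y$ and $n \neq 6xy - x - y$. In other words, the Twin Prime Conjecture is true if and only if there does not exist $N \in \mathbb{N}$ such that for every $n \geq N$ there are $x, y \in \mathbb{N}$ with $n = 6xy + x - y$ or $n = 6xy + x + y$ or $n = 6xy - x - y$.
   Context: $\mathbb{N} = \{1, 2, 3, \ldots\}$ denotes the set of positive integers (zero excluded). All the expressions $6xy \pm x \pm y$ are evaluated in the integers. *)

theory Defs
  imports "HOL-Computational_Algebra.Primes"
begin

definition twin_prime_conjecture :: bool where
  "twin_prime_conjecture \<longleftrightarrow> infinite {p :: nat. prime p \<and> prime (p + 2)}"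

end

theory Submission
  imports Defs
begin

text \<open>
  Every integer greater than 1 and coprime to 6 has the form \<open>6 x \<plusminus> 1\<close> with \<open>x \<ge> 1\<close>, so that \<open>n\<close> is
  represented by one of the three quadratic expressions if and only if \<open>6 n - 1\<close> or \<open>6 n + 1\<close> is
  composite: \<open>6 (6 x y + x - y) - 1 = (6 x - 1) (6 y + 1)\<close> and
  \<open>6 (6 x y \<plusminus> x \<plusminus> y) + 1 = (6 x \<plusminus> 1) (6 y \<plusminus> 1)\<close>.  On the other hand \<open>(6 n - 1, 6 n + 1)\<close> is the shape
  of all twin primes other than \<open>(3, 5)\<close>.
\<close>

text \<open>Working over \<open>int\<close> keeps the subtractions genuine, as truncated subtraction
  on \<open>nat\<close> could alter the values.\<close>

definition represented :: "int \<Rightarrow> bool" where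
  "represented n \<longleftrightarrow> (\<exists>x y. x \<ge> 1 \<and> y \<ge> 1 \<and>
     (n = 6 * x * y + x - y \<or> n = 6 * x * y + x + y \<or> n = 6 * x * y - x - y))"

lemma not_prime_int_factors:
  fixes m :: int
  assumes "m > 1" "\<not> prime m"
  obtains a b where "a > 1" "b > 1" "m = a * b"
proof -
  obtain a where a: "a \<ge> 0" "a dvd m" "a \<noteq> 1" "a \<noteq> m"
    using assms by (auto simp: prime_int_iff)
  then obtain b where b: "m = a * b" by (auto elim: dvdE)
  have "a > 1" using a b assms(1) by (cases "a = 0") auto
  moreover have "b > 0"
    using b assms(1) \<open>a > 1\<close> zero_less_mult_pos[of a b] by linarith
  then have "b > 1" using a b by (cases "b = 1") auto
  ultimately show ?thesis using that b by blast
qed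

lemma not_prime_int_mult:
  fixes a b :: int
  assumes "a > 1" "b > 1"
  shows "\<not> prime (a * b)"
proof
  assume "prime (a * b)"
  then have "a = 1 \<or> a = a * b"
    using assms(1) unfolding prime_int_iff by (meson dvd_triv_left less_le_not_le order_trans zero_le_one)
  then show False using assms by auto
qed

lemma coprime_six_form:
  fixes a :: int
  assumes "a > 1" "\<not> 2 dvd a" "\<not> 3 dvd a"
  obtains x where "x \<ge> 1" "a = 6 * x - 1" | x where "x \<ge> 1" "a = 6 * x + 1"
proof -
  have "\<exists>x. x \<ge> 1 \<and> (a = 6 * x - 1 \<or> a = 6 * x + 1)"
    using assms by presburger
  then show ?thesis using that by blast
qed

text \<open>A divisor of a number coprime to 6 is again coprime to 6. Only the left factor is
  treated; the right one follows by commuting the product.\<close>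

lemma factor_of_six_form:
  fixes a b n :: int
  assumes "a * b = 6 * n - 1 \<or> a * b = 6 * n + 1" "a > 1"
  obtains x where "x \<ge> 1" "a = 6 * x - 1" | x where "x \<ge> 1" "a = 6 * x + 1"
proof -
  have "\<not> 2 dvd c \<and> \<not> 3 dvd c" if "c = 6 * n - 1 \<or> c = 6 * n + 1" for c
    using that by presburger
  then have "\<not> 2 dvd a * b" "\<not> 3 dvd a * b" using assms(1) by blast+
  then have "\<not> 2 dvd a" "\<not> 3 dvd a" by (auto intro: dvd_mult2)
  then show ?thesis using coprime_six_form assms(2) that by blast
qed

text \<open>Both factors are 1 or -1 modulo 6, and their product is -1 only if the two residues
  differ. Comparing coefficients then gives the form \<open>6 * x * y + x - y\<close>.\<close>

lemma composite_minus_imp_represented: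
  assumes "n \<ge> 1" "\<not> prime (6 * n - 1)"
  shows "represented n"
proof -
  obtain a b where ab: "a > 1" "b > 1" "6 * n - 1 = a * b"
    using not_prime_int_factors[of "6 * n - 1"] assms by auto
  have rep: "represented n" if "x \<ge> 1" "y \<ge> 1" "6 * n - 1 = (6 * x - 1) * (6 * y + 1)" for x y
  proof -
    have "n = 6 * x * y + x - y" using that(3) by (simp add: algebra_simps)
    then show ?thesis using that unfolding represented_def by blast
  qed
  \<comment> \<open>The residues -1 and 1 modulo 6 are distinct, which rules out two factors of
    equal residue.\<close>
  have mixed: False if "6 * n - 1 = 6 * k + 1" for k using that by presburger
  have a: "a * b = 6 * n - 1 \<or> a * b = 6 * n + 1" and b: "b * a = 6 * n - 1 \<or> b * a = 6 * n + 1"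
    using ab by (simp_all add: mult.commute)
  show ?thesis
  proof (cases rule: factor_of_six_form[OF a ab(1)])
    case (1 x)
    show ?thesis
    proof (cases rule: factor_of_six_form[OF b ab(2)])
      case (1 y)
      have "6 * n - 1 = 6 * (6 * x * y - x - y) + 1"
        using ab(3) \<open>a = 6 * x - 1\<close> 1 by (simp add: algebra_simps)
      then show ?thesis using mixed by blast
    next
      case (2 y)
      show ?thesis using rep[of x y] 1 2 ab(3) by blast
    qed
  next
    case (2 x)
    show ?thesis
    proof (cases rule: factor_of_six_form[OF b ab(2)])
      case (1 y)
      \<comment> \<open>The first argument of \<open>rep\<close> belongs to the factor congruent to
        -1, here \<open>b\<close>. This swap is why \<open>6 * x * y - x + y\<close> need not be
        listed as a fourth form.\<close>
      show ?thesis using rep[of y x] 1 2 ab(3) by (metis mult.commute)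
    next
      case (2 y)
      have "6 * n - 1 = 6 * (6 * x * y + x + y) + 1"
        using ab(3) \<open>a = 6 * x + 1\<close> 2 by (simp add: algebra_simps)
      then show ?thesis using mixed by blast
    qed
  qed
qed

text \<open>Here the residues of the factors must agree: two factors -1 give
  \<open>6 * x * y - x - y\<close>, two factors 1 give \<open>6 * x * y + x + y\<close>.\<close>

lemma composite_plus_imp_represented:
  assumes "n \<ge> 1" "\<not> prime (6 * n + 1)"
  shows "represented n"
proof -
  obtain a b where ab: "a > 1" "b > 1" "6 * n + 1 = a * b"
    using not_prime_int_factors[of "6 * n + 1"] assms by auto
  have mixed: False if "6 * n + 1 = 6 * k - 1" for k using that by presburger
  have a: "a * b = 6 * n - 1 \<or> a * b = 6 * n + 1" and b: "b * a = 6 * n - 1 \<or> b * a = 6 * n + 1"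
    using ab by (simp_all add: mult.commute)
  show ?thesis
  proof (cases rule: factor_of_six_form[OF a ab(1)])
    case (1 x)
    show ?thesis
    proof (cases rule: factor_of_six_form[OF b ab(2)])
      case (1 y)
      have "n = 6 * x * y - x - y"
        using ab(3) \<open>a = 6 * x - 1\<close> 1 by (simp add: algebra_simps)
      then show ?thesis using \<open>x \<ge> 1\<close> 1 unfolding represented_def by blast
    next
      case (2 y)
      have "6 * n + 1 = 6 * (6 * x * y + x - y) - 1"
        using ab(3) 1 2 by (simp add: algebra_simps)
      then show ?thesis using mixed by blast
    qed
  next
    case (2 x)
    show ?thesis
    proof (cases rule: factor_of_six_form[OF b ab(2)])
      case (1 y)
      have "6 * n + 1 = 6 * (6 * x * y - x + y) - 1"
        using ab(3) 1 2 by (simp add: algebra_simps)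
      then show ?thesis using mixed by blast
    next
      case (2 y)
      have "n = 6 * x * y + x + y"
        using ab(3) \<open>a = 6 * x + 1\<close> 2 by (simp add: algebra_simps)
      then show ?thesis using \<open>x \<ge> 1\<close> 2 unfolding represented_def by blast
    qed
  qed
qed

text \<open>As \<open>x\<close> and \<open>y\<close> are at least 1, all factors
  \<open>6 * x - 1\<close>, \<open>6 * x + 1\<close> and their analogues in \<open>y\<close> are at
  least 5, so each factorization is proper.\<close>

lemma represented_imp_composite:
  assumes "represented n"
  shows "\<not> (prime (6 * n - 1) \<and> prime (6 * n + 1))"
proof -
  obtain x y where xy: "x \<ge> 1" "y \<ge> 1"
    and n: "n = 6 * x * y + x - y \<or> n = 6 * x * y + x + y \<or> n = 6 * x * y - x - y"
    using assms unfolding represented_def by blast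
  from n consider "6 * n - 1 = (6 * x - 1) * (6 * y + 1)"
    | "6 * n + 1 = (6 * x + 1) * (6 * y + 1)" | "6 * n + 1 = (6 * x - 1) * (6 * y - 1)"
    by (auto simp: algebra_simps)
  then show ?thesis
    by cases (use xy not_prime_int_mult in auto)
qed

lemma not_represented_iff_twin_primes:
  assumes "n \<ge> 1"
  shows "\<not> represented n \<longleftrightarrow> prime (6 * n - 1) \<and> prime (6 * n + 1)"
  using assms composite_minus_imp_represented composite_plus_imp_represented
    represented_imp_composite by blast

lemma twin_primes_eq:
  "{p :: nat. prime p \<and> prime (p + 2)} =
     insert 3 ((\<lambda>n. nat (6 * n - 1)) ` {n :: int. n \<ge> 1 \<and> prime (6 * n - 1) \<and> prime (6 * n + 1)})"
  (is "?L = insert 3 (?f ` ?R)")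
proof (intro subset_antisym subsetI)
  fix p assume "p \<in> ?L"
  then have p: "prime p" "prime (p + 2)" by auto
  show "p \<in> insert 3 (?f ` ?R)"
  proof (cases "p = 3")
    case False
    have p2: "p \<ge> 2" using p(1) by (rule prime_ge_2_nat)
    \<comment> \<open>Testing 2 against \<open>p + 2\<close> also excludes \<open>p = 2\<close>. The
      residues 0 and 1 modulo 3 are ruled out by \<open>p\<close> and \<open>p + 2\<close>, so an
      odd \<open>p\<close> is left with residue 5 modulo 6.\<close>
    have "\<not> 2 dvd p + 2" "\<not> 3 dvd p" "\<not> 3 dvd p + 2"
      using p2 False p primes_dvd_imp_eq[of 2 "p + 2"] primes_dvd_imp_eq[of 3 p]
        primes_dvd_imp_eq[of 3 "p + 2"] by auto
    then have "\<exists>n\<ge>1. int p = 6 * n - 1" using p2 by presburger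
    then obtain n where n: "n \<ge> 1" "int p = 6 * n - 1" by blast
    moreover have "prime (6 * n - 1)" using p(1) n(2) by (metis prime_nat_int_transfer)
    moreover have "int (p + 2) = 6 * n + 1" using n(2) by simp
    then have "prime (6 * n + 1)" using p(2) by (metis prime_nat_int_transfer)
    moreover have "p = nat (6 * n - 1)" using n(2) by simp
    ultimately show ?thesis by blast
  qed simp
next
  fix p assume "p \<in> insert 3 (?f ` ?R)"
  then consider "p = 3" | n where "n \<in> ?R" "p = nat (6 * n - 1)" by blast
  then show "p \<in> ?L"
  proof cases
    case 1
    then show ?thesis by simp
  next
    case 2
    then have "int p = 6 * n - 1" "int (p + 2) = 6 * n + 1" by auto
    moreover have "prime (6 * n - 1)" "prime (6 * n + 1)" using 2 by auto
    ultimately have "prime (int p)" "prime (int (p + 2))" by presburger+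
    then show ?thesis by (simp only: prime_nat_int_transfer mem_Collect_eq)
  qed
qed

lemma twin_prime_conjecture_iff:
  "twin_prime_conjecture \<longleftrightarrow> infinite {n. n \<ge> 1 \<and> \<not> represented n}"
proof -
  let ?R = "{n :: int. n \<ge> 1 \<and> prime (6 * n - 1) \<and> prime (6 * n + 1)}"
  \<comment> \<open>For \<open>n \<ge> 1\<close> the value \<open>6 * n - 1\<close> is positive, so
    \<open>nat\<close> loses nothing; the additional element 3 does not affect finiteness.\<close>
  have "inj_on (\<lambda>n. nat (6 * n - 1)) ?R" by (auto intro!: inj_onI)
  then have "twin_prime_conjecture \<longleftrightarrow> infinite ?R"
    unfolding twin_prime_conjecture_def twin_primes_eq by (simp add: finite_image_iff)
  also have "?R = {n. n \<ge> 1 \<and> \<not> represented n}"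
    using not_represented_iff_twin_primes by blast
  finally show ?thesis .
qed

text \<open>A set of integers bounded below is finite exactly when it is bounded above; this links
  the two formulations of the theorem.\<close>

lemma finite_int_ge_one_iff:
  "finite {n :: int. n \<ge> 1 \<and> \<not> P n} \<longleftrightarrow> (\<exists>N\<ge>1. \<forall>n\<ge>N. P n)" (is "finite ?A \<longleftrightarrow> _")
proof
  assume "finite ?A"
  then obtain M where M: "\<forall>n\<in>?A. n \<le> M"
    using bdd_above_finite[of ?A] by (auto simp: bdd_above_def)
  \<comment> \<open>If \<open>?A\<close> is empty, \<open>M\<close> may be any integer, so the
    maximum with 1 secures \<open>N \<ge> 1\<close>.\<close>
  have "\<forall>n\<ge>max 1 (M + 1). P n"
  proof (intro allI impI, rule ccontr)
    fix n assume "n \<ge> max 1 (M + 1)" "\<not> P n"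
    then show False using M by fastforce
  qed
  then show "\<exists>N\<ge>1. \<forall>n\<ge>N. P n" by (meson max.cobounded1)
next
  assume "\<exists>N\<ge>1. \<forall>n\<ge>N. P n"
  then obtain N where "\<forall>n\<ge>N. P n" by blast
  then have "?A \<subseteq> {1..N}" by (auto simp: not_le[symmetric]) (meson linear)
  then show "finite ?A" by (rule finite_subset) simp
qed

theorem theorem1p1:
  shows "(twin_prime_conjecture \<longleftrightarrow>
           infinite {n :: int. n \<ge> 1 \<and> (\<forall>x y :: int. x \<ge> 1 \<longrightarrow> y \<ge> 1 \<longrightarrow>
             n \<noteq> 6 * x * y + x - y \<and> n \<noteq> 6 * x * y + x + y \<and> n \<noteq> 6 * x * y - x - y)}) \<and>
         (twin_prime_conjecture \<longleftrightarrow>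
           \<not> (\<exists>N :: int. N \<ge> 1 \<and> (\<forall>n \<ge> N. \<exists>x y :: int. x \<ge> 1 \<and> y \<ge> 1 \<and>
             (n = 6 * x * y + x - y \<or> n = 6 * x * y + x + y \<or> n = 6 * x * y - x - y))))"
proof -
  have "{n :: int. n \<ge> 1 \<and> (\<forall>x y :: int. x \<ge> 1 \<longrightarrow> y \<ge> 1 \<longrightarrow>
      n \<noteq> 6 * x * y + x - y \<and> n \<noteq> 6 * x * y + x + y \<and> n \<noteq> 6 * x * y - x - y)} =
    {n. n \<ge> 1 \<and> \<not> represented n}"
    unfolding represented_def by blast
  then show ?thesis
    using twin_prime_conjecture_iff finite_int_ge_one_iff[of represented]
    unfolding represented_def by simp
qed

end
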